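(* Let $p,q\in\mathbb{C}^*$ with $p\neq q$. Let $A = \mathbb{C}[t,t^{-1}]$, let $\tau,\sigma$ be the $\mathbb{C}$-algebra endomorphisms of $A$ with $\tau(t)=pt$, $\sigma(t)=qt$, and let $D = \dfrac{\tau-\sigma}{p-q}$, a $(\tau,\sigma)$-derivation of $A$. Then the $\mathbb{C}$-linear space $$W_{p,q} = \bigoplus_{n \in \mathbb{Z}} \mathbb{C} \cdot d_n, \qquad d_n = -t^n \cdot D,$$ can be endowed with a structure of Hom-Lie algebra with the bracket defined on generators by $$[d_n, d_m]' = (q^m [n] - q^n [m]) d_{n+m} = (p^m [n] - p^n [m]) d_{n+m}$$ and with the twist $\overline{\sigma + \tau} : W_{p,q} \to W_{p,q}$ defined by $$\overline{\sigma + \tau}(d_n) = (p^n+q^n)d_n.$$ The bracket satisfies skew-symmetry $[d_m,d_n]' = - [d_n,d_m]'$ and the Hom-Jacobi identity: for all $n,m,k\in\mathbb{Z}$, $$\circlearrowleft_{n,m,k} [(p^n+q^n)d_n,[d_m,d_k]']' = 0.$$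
   Context: A $(\tau,\sigma)$-derivation of $A$ is a $\mathbb{C}$-linear map $D : A \to A$ with $D(ab)=D(a)\tau(b)+\sigma(a)D(b)$ for all $a,b\in A$. For $a\in A$, $a\cdot D$ is the map $x\mapsto aD(x)$. For a linear map $\beta: A\to A$, $\overline{\beta}(a\cdot D)=\beta(a)\cdot D$. For $n\in\mathbb{Z}$, $[n]=[n]_{p,q} = \dfrac{p^n-q^n}{p-q}$. The symbol $\circlearrowleft_{n,m,k}$ denotes the sum over cyclic permutations of $(n,m,k)$. A Hom-Lie algebra over $\mathbb{C}$ is a triple $(L,[\cdot,\cdot],\alpha)$ with $L$ a vector space, $[\cdot,\cdot]$ a bilinear skew-symmetric bracket on $L$ and $\alpha:L\to L$ a linear map (the twist) such that $[\alpha(x),[y,z]]+[\alpha(y),[z,x]]+[\alpha(z),[x,y]]=0$ for all $x,y,z\in L$. *)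

theory Defs
  imports Complex_Main "HOL-Library.Poly_Mapping" "HOL-Library.Function_Algebras"
begin

text \<open>
  Laurent polynomials over the complex numbers: finitely supported functions from the
  exponents \<open>int\<close> to the coefficients, with the convolution product of \<open>Poly_Mapping\<close>.
\<close>
type_synonym laurent = "int \<Rightarrow>\<^sub>0 complex"

text \<open>The monomial \<open>t\<^sup>n\<close>, for any integer \<open>n\<close>.\<close>
definition tpow :: "int \<Rightarrow> laurent" where
  "tpow n = Poly_Mapping.single n 1"

definition lscale :: "complex \<Rightarrow> laurent \<Rightarrow> laurent" where
  "lscale c f = Poly_Mapping.single 0 c * f"

text \<open>
  Pointwise scaling of self-maps of \<open>laurent\<close>; their addition, negation and subtraction are
  the pointwise ones of \<open>Function_Algebras\<close>.
\<close>
definition fscale :: "complex \<Rightarrow> (laurent \<Rightarrow> laurent) \<Rightarrow> laurent \<Rightarrow> laurent" where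
  "fscale c X = (\<lambda>f. lscale c (X f))"

definition algebra_endo :: "(laurent \<Rightarrow> laurent) \<Rightarrow> bool" where
  "algebra_endo \<phi> \<longleftrightarrow> Vector_Spaces.linear lscale lscale \<phi> \<and> \<phi> 1 = 1 \<and>
     (\<forall>a b. \<phi> (a * b) = \<phi> a * \<phi> b)"

definition twisted_derivation ::
    "(laurent \<Rightarrow> laurent) \<Rightarrow> (laurent \<Rightarrow> laurent) \<Rightarrow> (laurent \<Rightarrow> laurent) \<Rightarrow> bool" where
  "twisted_derivation \<tau> \<sigma> D \<longleftrightarrow> Vector_Spaces.linear lscale lscale D \<and>
     (\<forall>a b. D (a * b) = D a * \<tau> b + \<sigma> a * D b)"

definition act :: "laurent \<Rightarrow> (laurent \<Rightarrow> laurent) \<Rightarrow> laurent \<Rightarrow> laurent" where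
  "act a D = (\<lambda>x. a * D x)"

text \<open>
  The map sending \<open>act a D\<close> to \<open>act (\<beta> a) D\<close>.  It is meaningful only on operators of the
  form \<open>act a D\<close>, and when \<open>a\<close> is determined by \<open>act a D\<close>.
\<close>
definition overline ::
    "(laurent \<Rightarrow> laurent) \<Rightarrow> (laurent \<Rightarrow> laurent) \<Rightarrow> (laurent \<Rightarrow> laurent) \<Rightarrow> laurent \<Rightarrow> laurent"
  where "overline D \<beta> X = act (\<beta> (THE a. X = act a D)) D"

definition pq_number :: "complex \<Rightarrow> complex \<Rightarrow> int \<Rightarrow> complex" where
  "pq_number p q n = (p powi n - q powi n) / (p - q)"

text \<open>
  The underlying space \<open>L\<close> is a linear subspace of an ambient complex vector space; the bracket
  and the twist are constrained on \<open>L\<close> only.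
\<close>
locale hom_lie_algebra = vector_space scale
  for scale :: "complex \<Rightarrow> 'v::ab_group_add \<Rightarrow> 'v" +
  fixes L :: "'v set" and br :: "'v \<Rightarrow> 'v \<Rightarrow> 'v" and \<alpha> :: "'v \<Rightarrow> 'v"
  assumes subspace_L: "subspace L"
    and br_closed: "\<lbrakk>x \<in> L; y \<in> L\<rbrakk> \<Longrightarrow> br x y \<in> L"
    and br_add_left: "\<lbrakk>x \<in> L; y \<in> L; z \<in> L\<rbrakk> \<Longrightarrow> br (x + y) z = br x z + br y z"
    and br_add_right: "\<lbrakk>x \<in> L; y \<in> L; z \<in> L\<rbrakk> \<Longrightarrow> br x (y + z) = br x y + br x z"
    and br_scale_left: "\<lbrakk>x \<in> L; y \<in> L\<rbrakk> \<Longrightarrow> br (scale c x) y = scale c (br x y)"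
    and br_scale_right: "\<lbrakk>x \<in> L; y \<in> L\<rbrakk> \<Longrightarrow> br x (scale c y) = scale c (br x y)"
    and twist_closed: "x \<in> L \<Longrightarrow> \<alpha> x \<in> L"
    and twist_add: "\<lbrakk>x \<in> L; y \<in> L\<rbrakk> \<Longrightarrow> \<alpha> (x + y) = \<alpha> x + \<alpha> y"
    and twist_scale: "x \<in> L \<Longrightarrow> \<alpha> (scale c x) = scale c (\<alpha> x)"
    and br_skew: "\<lbrakk>x \<in> L; y \<in> L\<rbrakk> \<Longrightarrow> br x y = - br y x"
    and hom_jacobi: "\<lbrakk>x \<in> L; y \<in> L; z \<in> L\<rbrakk> \<Longrightarrow>
      br (\<alpha> x) (br y z) + br (\<alpha> y) (br z x) + br (\<alpha> z) (br x y) = 0"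

lemma vector_space_lscale: "vector_space lscale"
  by unfold_locales
    (simp_all add: lscale_def algebra_simps single_add mult_single flip: mult.assoc)

lemma lookup_lscale: "Poly_Mapping.lookup (lscale c f) n = c * Poly_Mapping.lookup f n"
proof -
  have "lscale c f = Poly_Mapping.map ((*) c) f"
    unfolding lscale_def mult_map_scale_conv_mult by simp
  then show ?thesis
    by (simp add: Poly_Mapping.map.rep_eq when_def)
qed

lemma laurent_expand: "f = (\<Sum>n\<in>Poly_Mapping.keys f. lscale (Poly_Mapping.lookup f n) (tpow n))"
proof (rule poly_mapping_eqI)
  fix k
  have "Poly_Mapping.lookup (\<Sum>n\<in>Poly_Mapping.keys f. lscale (Poly_Mapping.lookup f n) (tpow n)) k
      = (\<Sum>n\<in>Poly_Mapping.keys f. if n = k then Poly_Mapping.lookup f n else 0)"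
    unfolding lookup_sum lookup_lscale tpow_def lookup_single
    by (intro sum.cong) (auto simp: when_def)
  then show "Poly_Mapping.lookup f k = Poly_Mapping.lookup
      (\<Sum>n\<in>Poly_Mapping.keys f. lscale (Poly_Mapping.lookup f n) (tpow n)) k"
    by (simp add: sum.delta' in_keys_iff)
qed

lemma tpow_mult: "tpow m * tpow n = tpow (m + n)"
  by (simp add: tpow_def mult_single)

lemma tpow_0: "tpow 0 = 1"
  by (simp add: tpow_def)

lemma laurent_induct [case_names mono add]:
  assumes "\<And>c n. P (lscale c (tpow n))" and "\<And>f g. P f \<Longrightarrow> P g \<Longrightarrow> P (f + g)"
  shows "P f"
proof -
  have P0: "P 0" using assms(1)[of 0 0] by (simp add: lscale_def)
  have "P (\<Sum>n\<in>A. lscale (Poly_Mapping.lookup f n) (tpow n))" for A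
    by (induction A rule: infinite_finite_induct) (auto intro: assms P0)
  then show ?thesis using laurent_expand[of f] by metis
qed

text \<open>The endomorphism with \<open>t \<mapsto> c t\<close> exists and is unique for every nonzero \<open>c\<close>.\<close>
lemma algebra_endo_ex1:
  assumes c: "c \<noteq> 0"
  shows "\<exists>!\<phi>. algebra_endo \<phi> \<and> \<phi> (tpow 1) = lscale c (tpow 1)"
proof (rule ex_ex1I)
  interpret V: vector_space lscale by (rule vector_space_lscale)
  define \<phi> where "\<phi> = Poly_Mapping.mapp (\<lambda>n x. c powi n * x)"
  have lk: "Poly_Mapping.lookup (\<phi> f) n = c powi n * Poly_Mapping.lookup f n" for f :: laurent and n
    by (simp add: \<phi>_def lookup_mapp when_def in_keys_iff)
  have add: "\<phi> (f + g) = \<phi> f + \<phi> g" for f g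
    by (rule poly_mapping_eqI) (simp add: lk lookup_add algebra_simps)
  have sc: "\<phi> (lscale k f) = lscale k (\<phi> f)" for k f
    by (rule poly_mapping_eqI) (simp add: lk lookup_lscale)
  have tp: "\<phi> (tpow n) = lscale (c powi n) (tpow n)" for n
    by (rule poly_mapping_eqI) (simp add: lk lookup_lscale tpow_def lookup_single when_def)
  have lm: "lscale k f * g = lscale k (f * g)" "f * lscale k g = lscale k (f * g)" for k f g
    by (simp_all add: lscale_def mult_ac)
  have mult: "\<phi> (f * g) = \<phi> f * \<phi> g" for f g
  proof (induction f rule: laurent_induct)
    case (mono a n)
    show ?case
    proof (induction g rule: laurent_induct)
      case (mono b m)
      show ?case
        using c by (simp add: lm sc tp tpow_mult power_int_add mult_ac)
    qed (simp add: add distrib_left)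
  qed (simp add: add distrib_right)
  have one: "\<phi> 1 = 1" using tp[of 0] by (simp add: tpow_0)
  have "Vector_Spaces.linear lscale lscale \<phi>"
    by unfold_locales (simp_all add: add sc)
  then show "\<exists>\<phi>. algebra_endo \<phi> \<and> \<phi> (tpow 1) = lscale c (tpow 1)"
    using mult one tp[of 1] by (auto simp: algebra_endo_def)
next
  interpret V: vector_space lscale by (rule vector_space_lscale)
  have lm: "lscale k f * g = lscale k (f * g)" "f * lscale k g = lscale k (f * g)" for k f g
    by (simp_all add: lscale_def mult_ac)
  have pow: "\<phi> (tpow n) = lscale (c powi n) (tpow n)"
    if \<phi>: "algebra_endo \<phi>" "\<phi> (tpow 1) = lscale c (tpow 1)" for \<phi> n
  proof -
    have m: "\<phi> (a * b) = \<phi> a * \<phi> b" and o: "\<phi> 1 = 1" for a b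
      using \<phi> by (auto simp: algebra_endo_def)
    have nn: "\<phi> (tpow (int k)) = lscale (c powi int k) (tpow (int k))" for k
    proof (induction k)
      case (Suc k)
      have e: "tpow (int (Suc k)) = tpow 1 * tpow (int k)" by (simp add: tpow_mult)
      have "\<phi> (tpow (int (Suc k))) = lscale (c * c powi int k) (tpow 1 * tpow (int k))"
        unfolding e m Suc \<phi>(2) lm by simp
      moreover have "c powi int (Suc k) = c * c powi int k"
        by (simp only: power_int_of_nat power_Suc)
      ultimately show ?case by (simp only: e)
    qed (simp add: tpow_0 o)
    show ?thesis
    proof (cases "n \<ge> 0")
      case True
      then show ?thesis using nn[of "nat n"] by simp
    next
      case False
      then obtain k where k: "n = - int k" by (cases n rule: int_cases2) auto
      have a: "\<phi> (tpow (int k)) * \<phi> (tpow n) = 1"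
        unfolding m[symmetric] tpow_mult by (simp add: k tpow_0 o)
      have b: "lscale (c powi n) (tpow n) * \<phi> (tpow (int k)) = 1"
        using c by (simp add: nn lm tpow_mult k tpow_0 power_int_minus)
      have "\<phi> (tpow n) = lscale (c powi n) (tpow n) * \<phi> (tpow (int k)) * \<phi> (tpow n)"
        by (simp only: b mult_1_left)
      also have "\<dots> = lscale (c powi n) (tpow n)"
        by (simp only: mult.assoc a mult_1_right)
      finally show ?thesis .
    qed
  qed
  fix \<phi> \<psi>
  assume 1: "algebra_endo \<phi> \<and> \<phi> (tpow 1) = lscale c (tpow 1)"
    and 2: "algebra_endo \<psi> \<and> \<psi> (tpow 1) = lscale c (tpow 1)"
  interpret F: Vector_Spaces.linear lscale lscale \<phi> using 1 by (simp add: algebra_endo_def)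
  interpret G: Vector_Spaces.linear lscale lscale \<psi> using 2 by (simp add: algebra_endo_def)
  have "\<phi> f = \<psi> f" for f
    by (induction f rule: laurent_induct) (use 1 2 in \<open>simp_all add: F.scale G.scale F.add G.add pow\<close>)
  then show "\<phi> = \<psi>" by blast
qed

end

theory Submission
  imports Defs
begin

text \<open>
  The map \<open>a \<mapsto> act a D\<close> is a linear isomorphism from the Laurent polynomials onto \<open>W\<close>, since
  \<open>D t = t\<close> is invertible.  It therefore suffices to find the Hom-Lie structure on the Laurent
  polynomials.  There the bracket \<open>\<sigma> a * D b - \<sigma> b * D a\<close> equals
  \<open>(\<sigma> a * \<tau> b - \<sigma> b * \<tau> a) / (p - q)\<close>, and the Hom-Jacobi identity for the latter is a
  formal cancellation that only uses that \<open>\<sigma>\<close> and \<open>\<tau>\<close> are commuting ring endomorphisms.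
\<close>

lemma hom_jacobi_commuting_endos:
  fixes s t :: "'a::comm_ring \<Rightarrow> 'a"
  assumes "\<And>x y. s (x - y) = s x - s y" and "\<And>x y. t (x - y) = t x - t y"
    and "\<And>x y. s (x * y) = s x * s y" and "\<And>x y. t (x * y) = t x * t y"
    and "\<And>x y. s (x + y) = s x + s y" and "\<And>x y. t (x + y) = t x + t y"
    and "\<And>x. s (t x) = t (s x)"
  defines "B \<equiv> \<lambda>x y. s x * t y - s y * t x"
  shows "B (s x + t x) (B y z) + B (s y + t y) (B z x) + B (s z + t z) (B x y) = 0"
  \<comment> \<open>Since \<open>s\<close> and \<open>t\<close> commute, everything expands into
    products with one factor for each of \<open>x\<close>, \<open>y\<close>, \<open>z\<close>,
    namely \<open>s (s u)\<close>, \<open>s (t u)\<close> or \<open>t (t u)\<close> for that element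
    \<open>u\<close>. In each of the three summands the eight terms form four pairs of opposite sign
    that are cyclic shifts of one another, so the cyclic sum vanishes.\<close>
  unfolding B_def by (simp add: assms(1-7) algebra_simps)

text \<open>Transport of structure: \<open>inv \<Phi>\<close> undoes \<open>\<Phi>\<close> on its
  range, so each axiom is the \<open>\<Phi>\<close>-image of the one for \<open>B\<close>. The new
  twist is prescribed on the range only, which suits \<open>overline\<close>, meaningful only on
  operators \<open>act a D\<close>.\<close>

lemma hom_lie_algebra_image:
  assumes hl: "hom_lie_algebra s1 UNIV B \<alpha>" and lin: "Vector_Spaces.linear s1 s2 \<Phi>"
    and inj: "inj \<Phi>" and \<alpha>': "\<And>a. \<alpha>' (\<Phi> a) = \<Phi> (\<alpha> a)"
  shows "hom_lie_algebra s2 (range \<Phi>) (\<lambda>x y. \<Phi> (B (inv \<Phi> x) (inv \<Phi> y))) \<alpha>'"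
proof -
  interpret H: hom_lie_algebra s1 UNIV B \<alpha> by (rule hl)
  interpret F: Vector_Spaces.linear s1 s2 \<Phi> by (rule lin)
  have inv: "inv \<Phi> (\<Phi> a) = a" for a using inj by simp
  have tr: "\<Phi> a + \<Phi> b = \<Phi> (a + b)" "s2 c (\<Phi> a) = \<Phi> (s1 c a)" "- \<Phi> a = \<Phi> (- a)" for a b c
    by (simp_all add: F.add F.scale F.neg)
  show ?thesis
  proof unfold_locales
    show "F.vs2.subspace (range \<Phi>)"
      using F.subspace_image[OF H.subspace_L] .
  qed (auto simp: inv tr \<alpha>' H.br_add_left H.br_add_right H.br_scale_left H.br_scale_right
      H.twist_add H.twist_scale H.hom_jacobi F.zero intro: arg_cong[OF H.br_skew])
qed

lemma lscale_mult: "lscale c f * g = lscale c (f * g)" "f * lscale c g = lscale c (f * g)"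
  by (simp_all add: lscale_def mult_ac)

lemma tpow_eq_iff: "tpow m = tpow n \<longleftrightarrow> m = n"
  by (metis lookup_single_eq lookup_single_not_eq one_neq_zero tpow_def)

lemma vector_space_fscale: "vector_space fscale"
proof -
  interpret V: vector_space lscale by (rule vector_space_lscale)
  show ?thesis
    by unfold_locales
      (simp_all add: fscale_def fun_eq_iff V.scale_right_distrib V.scale_left_distrib)
qed

lemma linear_act: "Vector_Spaces.linear lscale fscale (\<lambda>a. act a X)"
proof -
  interpret V: vector_space lscale by (rule vector_space_lscale)
  interpret F: vector_space fscale by (rule vector_space_fscale)
  show ?thesis
    by unfold_locales (simp_all add: act_def fscale_def fun_eq_iff distrib_right lscale_mult)
qed

lemma algebra_endo_comp:
  assumes "algebra_endo \<phi>" and "algebra_endo \<psi>"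
  shows "algebra_endo (\<phi> \<circ> \<psi>)"
  using assms by (auto simp: algebra_endo_def intro: Vector_Spaces.linear_compose)

lemma algebra_endo_tpow:
  assumes \<phi>: "algebra_endo \<phi>" "\<phi> (tpow 1) = lscale c (tpow 1)" and c: "c \<noteq> 0"
  shows "\<phi> (tpow n) = lscale (c powi n) (tpow n)"
proof -
  interpret V: vector_space lscale by (rule vector_space_lscale)
  have m: "\<phi> (a * b) = \<phi> a * \<phi> b" and o: "\<phi> 1 = 1" for a b
    using \<phi> by (auto simp: algebra_endo_def)
  have step: "\<phi> (tpow (i + 1)) = lscale c (\<phi> (tpow i) * tpow 1)" for i
    unfolding tpow_mult[symmetric] m \<phi>(2) lscale_mult ..
  show ?thesis
  proof (induction n rule: int_induct[where k = 0])
    case base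
    show ?case by (simp add: tpow_0 o)
  next
    case (step1 i)
    then show ?case
      using c by (simp add: step lscale_mult tpow_mult power_int_add mult.commute add.commute[of 1])
  next
    case (step2 i)
    \<comment> \<open>For negative exponents \<open>step\<close> is solved backwards: multiplication
      by \<open>tpow (-1)\<close> removes the factor \<open>tpow 1\<close>, and the scalar
      \<open>c\<close> is invertible.\<close>
    have "\<phi> (tpow (i - 1)) = lscale (1 / c) (\<phi> (tpow i) * tpow (-1))"
      using step[of "i - 1"] c by (simp add: lscale_mult mult.assoc tpow_mult tpow_0)
    with step2 show ?case
      using c by (simp add: lscale_mult tpow_mult power_int_diff)
  qed
qed

text \<open>Both composites are algebra endomorphisms that scale the generator by
  \<open>b * c\<close>, so the uniqueness in \<open>algebra_endo_ex1\<close> identifies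
  them.\<close>

lemma algebra_endo_commute:
  assumes \<phi>: "algebra_endo \<phi>" "\<phi> (tpow 1) = lscale b (tpow 1)"
    and \<psi>: "algebra_endo \<psi>" "\<psi> (tpow 1) = lscale c (tpow 1)"
    and nz: "b \<noteq> 0" "c \<noteq> 0"
  shows "\<phi> (\<psi> x) = \<psi> (\<phi> x)"
proof -
  interpret V: vector_space lscale by (rule vector_space_lscale)
  have sc: "\<phi> (lscale k f) = lscale k (\<phi> f)" "\<psi> (lscale k f) = lscale k (\<psi> f)" for k f
    using \<phi>(1) \<psi>(1) by (simp_all add: algebra_endo_def linear_iff_module_hom module_hom.scale)
  have "\<phi> \<circ> \<psi> = \<psi> \<circ> \<phi>"
    using algebra_endo_ex1[of "b * c"] nz algebra_endo_comp[OF \<phi>(1) \<psi>(1)]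
      algebra_endo_comp[OF \<psi>(1) \<phi>(1)]
    by (auto simp: sc \<phi>(2) \<psi>(2) mult.commute)
  then show ?thesis by (simp add: fun_eq_iff)
qed

lemma span_tpow: "module.span lscale (range tpow) = UNIV"
proof -
  interpret V: vector_space lscale by (rule vector_space_lscale)
  have "f \<in> V.span (range tpow)" for f
    by (induction f rule: laurent_induct) (auto intro: V.span_scale V.span_base V.span_add)
  then show ?thesis by blast
qed

text \<open>The coefficient at exponent \<open>n\<close> vanishes on the span of all other
  monomials, but it is 1 on \<open>tpow n\<close>.\<close>

lemma independent_tpow: "\<not> module.dependent lscale (range tpow)"
proof -
  interpret V: vector_space lscale by (rule vector_space_lscale)
  have "tpow n \<notin> V.span (range tpow - {tpow n})" for n
  proof -
    have "V.subspace {f. Poly_Mapping.lookup f n = 0}"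
      by (auto simp: V.subspace_def lookup_add lookup_lscale)
    then have "V.span (range tpow - {tpow n}) \<subseteq> {f. Poly_Mapping.lookup f n = 0}"
      by (rule V.span_minimal[rotated])
        (auto simp: tpow_def lookup_single when_def)
    then show ?thesis by (auto simp: tpow_def)
  qed
  then show ?thesis by (auto simp: V.dependent_def)
qed

theorem theorem3p4:
  fixes p q :: complex
    and \<tau> \<sigma> D :: "laurent \<Rightarrow> laurent"
    and d :: "int \<Rightarrow> laurent \<Rightarrow> laurent"
    and W :: "(laurent \<Rightarrow> laurent) set"
  assumes "p \<noteq> 0" and "q \<noteq> 0" and "p \<noteq> q"
    and "algebra_endo \<tau>" and "\<tau> (tpow 1) = lscale p (tpow 1)"
    and "algebra_endo \<sigma>" and "\<sigma> (tpow 1) = lscale q (tpow 1)"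
    and "D = fscale (1 / (p - q)) (\<tau> - \<sigma>)"
    and "d = (\<lambda>n. act (- tpow n) D)"
    and "W = module.span fscale (range d)"
  shows "twisted_derivation \<tau> \<sigma> D \<and>
    inj d \<and> \<not> module.dependent fscale (range d) \<and>
    (\<forall>a. overline D (\<sigma> + \<tau>) (act a D) = act ((\<sigma> + \<tau>) a) D) \<and>
    (\<forall>n. overline D (\<sigma> + \<tau>) (d n) = fscale (p powi n + q powi n) (d n)) \<and>
    (\<exists>br.
      hom_lie_algebra fscale W br (overline D (\<sigma> + \<tau>)) \<and>
      (\<forall>n m. br (d n) (d m)
          = fscale (q powi m * pq_number p q n - q powi n * pq_number p q m) (d (n + m)) \<and>
        fscale (q powi m * pq_number p q n - q powi n * pq_number p q m) (d (n + m))
          = fscale (p powi m * pq_number p q n - p powi n * pq_number p q m) (d (n + m))) \<and>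
      (\<forall>n m. br (d m) (d n) = - br (d n) (d m)) \<and>
      (\<forall>n m k.
        br (fscale (p powi n + q powi n) (d n)) (br (d m) (d k)) +
        br (fscale (p powi m + q powi m) (d m)) (br (d k) (d n)) +
        br (fscale (p powi k + q powi k) (d k)) (br (d n) (d m)) = 0))"
proof -
  interpret V: vector_space lscale by (rule vector_space_lscale)
  interpret F: vector_space fscale by (rule vector_space_fscale)
  interpret T: Vector_Spaces.linear lscale lscale \<tau> using assms(4) by (simp add: algebra_endo_def)
  interpret S: Vector_Spaces.linear lscale lscale \<sigma> using assms(6) by (simp add: algebra_endo_def)
  note nz = assms(1,2)
  have pq: "p - q \<noteq> 0" using assms(3) by simp
  have mult: "\<tau> (a * b) = \<tau> a * \<tau> b" "\<sigma> (a * b) = \<sigma> a * \<sigma> b" for a b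
    using assms(4,6) by (simp_all add: algebra_endo_def)
  have comm: "\<sigma> (\<tau> x) = \<tau> (\<sigma> x)" for x
    by (rule algebra_endo_commute[OF assms(6,7,4,5) nz(2,1)])
  have \<tau>_tpow: "\<tau> (tpow n) = lscale (p powi n) (tpow n)"
    and \<sigma>_tpow: "\<sigma> (tpow n) = lscale (q powi n) (tpow n)" for n
    using algebra_endo_tpow assms(4-7) nz by blast+
  have D: "D x = lscale (1 / (p - q)) (\<tau> x - \<sigma> x)" for x
    by (simp add: assms(8) fscale_def)

  have "Vector_Spaces.linear lscale lscale D"
    by unfold_locales
      (simp_all add: D T.add S.add T.scale S.scale V.scale_right_diff_distrib
        V.scale_right_distrib mult.commute)
  \<comment> \<open>In \<open>D a * \<tau> b + \<sigma> a * D b\<close> the mixed terms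
    \<open>\<sigma> a * \<tau> b\<close> cancel, leaving the difference of
    \<open>\<tau> (a * b)\<close> and \<open>\<sigma> (a * b)\<close> over
    \<open>p - q\<close>.\<close>
  moreover have "D (a * b) = D a * \<tau> b + \<sigma> a * D b" for a b
    by (simp add: D mult lscale_mult V.scale_right_diff_distrib algebra_simps)
  ultimately have der: "twisted_derivation \<tau> \<sigma> D"
    by (simp add: twisted_derivation_def)

  define \<Phi> where "\<Phi> = (\<lambda>a. act a D)"
  have lin_\<Phi>: "Vector_Spaces.linear lscale fscale \<Phi>"
    unfolding \<Phi>_def by (rule linear_act)
  interpret P: Vector_Spaces.linear lscale fscale \<Phi> by (rule lin_\<Phi>)
  have D_t: "D (tpow 1) = tpow 1"
    using pq by (simp add: D assms(5,7) flip: V.scale_left_diff_distrib)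
  have inj: "inj \<Phi>"
  proof (rule injI)
    fix a b assume "\<Phi> a = \<Phi> b"
    \<comment> \<open>Both operators are evaluated at the unit \<open>tpow 1\<close>, which
      \<open>D\<close> fixes.\<close>
    then have "a * tpow 1 * tpow (-1) = b * tpow 1 * tpow (-1)"
      unfolding \<Phi>_def act_def by (metis D_t)
    then show "a = b" by (simp add: mult.assoc tpow_mult tpow_0)
  qed
  have d: "d n = - \<Phi> (tpow n)" for n
    by (simp add: assms(9) \<Phi>_def act_def fun_eq_iff)
  have ov: "overline D (\<sigma> + \<tau>) (\<Phi> a) = \<Phi> ((\<sigma> + \<tau>) a)" for a
  proof -
    \<comment> \<open>Injectivity of \<open>\<Phi>\<close> is what gives the definite description in
      \<open>overline\<close> its value.\<close>
    have "(THE b. \<Phi> a = act b D) = a"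
      using inj by (intro the_equality) (auto simp: \<Phi>_def inj_def)
    then show ?thesis by (simp add: overline_def \<Phi>_def)
  qed
  have ov_d: "overline D (\<sigma> + \<tau>) (d n) = fscale (p powi n + q powi n) (d n)" for n
    unfolding d P.neg[symmetric] ov
    by (simp add: T.neg S.neg \<tau>_tpow \<sigma>_tpow P.neg P.add P.diff P.scale F.scale_left_distrib)

  have inj_d: "inj d"
    by (rule injI) (simp add: d inj_eq[OF inj] tpow_eq_iff)
  \<comment> \<open>Moving the sign of \<open>d n\<close> from the coefficient to the operator
    exhibits \<open>range d\<close> as the image of the monomials under one injective linear map, so
    span and independence carry over.\<close>
  interpret N: Vector_Spaces.linear lscale fscale "\<lambda>a. act a (- D)"
    by (rule linear_act)
  have N: "act a (- D) = \<Phi> (- a)" for a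
    by (simp add: \<Phi>_def act_def fun_eq_iff)
  have range_d: "range d = (\<lambda>a. act a (- D)) ` range tpow"
    by (auto simp: d N P.neg image_image)
  have indep: "\<not> F.dependent (range d)"
    unfolding range_d
    by (rule N.independent_injective_image[OF independent_tpow])
      (simp add: inj_on_def N inj_eq[OF inj])
  have W: "W = range \<Phi>"
  proof -
    have "W = range (\<lambda>a. \<Phi> (- a))"
      unfolding assms(10) range_d N.span_image span_tpow by (simp add: N)
    also have "\<dots> = \<Phi> ` range uminus" by (simp only: image_image)
    finally show ?thesis by (simp only: surj_uminus)
  qed

  define B where "B = (\<lambda>a b. lscale (1 / (p - q)) (\<sigma> a * \<tau> b - \<sigma> b * \<tau> a))"
  \<comment> \<open>Outside \<open>range \<Phi>\<close> the values of \<open>inv \<Phi>\<close> are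
    arbitrary; the axioms constrain the bracket on \<open>W\<close> only.\<close>
  define br where "br = (\<lambda>x y. \<Phi> (B (inv \<Phi> x) (inv \<Phi> y)))"
  have B_UNIV: "hom_lie_algebra lscale UNIV B (\<sigma> + \<tau>)"
  proof unfold_locales
    fix x y z
    show "B x y = - B y x"
      by (simp add: B_def flip: V.scale_minus_right)
    let ?c = "1 / (p - q)" and ?B = "\<lambda>a b. \<sigma> a * \<tau> b - \<sigma> b * \<tau> a"
    \<comment> \<open>The scalar leaves the nested bracket once per level, the same for all three
      summands, which reduces Hom-Jacobi to the identity for commuting ring endomorphisms.\<close>
    have "B u (B v w) = lscale ?c (lscale ?c (?B u (?B v w)))" for u v w
      by (simp add: B_def S.scale T.scale S.diff T.diff lscale_mult V.scale_right_diff_distrib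
          left_diff_distrib right_diff_distrib)
    then show "B ((\<sigma> + \<tau>) x) (B y z) + B ((\<sigma> + \<tau>) y) (B z x) + B ((\<sigma> + \<tau>) z) (B x y) = 0"
      using hom_jacobi_commuting_endos[of \<sigma> \<tau> x y z]
      by (simp add: mult comm S.add T.add S.diff T.diff flip: V.scale_right_distrib)
  qed (simp_all add: B_def S.add T.add S.scale T.scale lscale_mult V.scale_right_diff_distrib
      V.scale_right_distrib algebra_simps mult.commute)
  have hl: "hom_lie_algebra fscale W br (overline D (\<sigma> + \<tau>))"
    unfolding W br_def
    by (rule hom_lie_algebra_image[where \<alpha> = "\<sigma> + \<tau>", OF B_UNIV lin_\<Phi> inj]) (rule ov)
  interpret H: hom_lie_algebra fscale W br "overline D (\<sigma> + \<tau>)" by (rule hl)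
  have dW: "d n \<in> W" for n
    by (simp add: W d flip: P.neg)
  \<comment> \<open>The terms \<open>q powi m * q powi n\<close> cancel in the first form and
    \<open>p powi m * p powi n\<close> in the second, so both have the same value.\<close>
  have coeff: "q powi m * pq_number p q n - q powi n * pq_number p q m
      = (p powi n * q powi m - p powi m * q powi n) / (p - q)"
    "p powi m * pq_number p q n - p powi n * pq_number p q m
      = (p powi n * q powi m - p powi m * q powi n) / (p - q)" for n m
    by (simp_all add: pq_number_def algebra_simps flip: diff_divide_distrib)
  have br_d: "br (d n) (d m)
      = fscale (q powi m * pq_number p q n - q powi n * pq_number p q m) (d (n + m))" for n m
  proof -
    have "br (d n) (d m) = \<Phi> (B (- tpow n) (- tpow m))"
      unfolding br_def d P.neg[symmetric] inv_f_f[OF inj] ..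
    also have "B (- tpow n) (- tpow m)
        = lscale ((p powi m * q powi n - p powi n * q powi m) / (p - q)) (tpow (n + m))"
      by (simp add: B_def S.neg T.neg \<tau>_tpow \<sigma>_tpow lscale_mult tpow_mult add.commute mult.commute
          flip: V.scale_left_diff_distrib)
    \<comment> \<open>The signs of the two arguments cancelled inside \<open>B\<close>; the sign in
      \<open>d (n + m)\<close> remains and reverses the difference in the coefficient.\<close>
    also have "\<Phi> \<dots> = fscale ((p powi n * q powi m - p powi m * q powi n) / (p - q)) (d (n + m))"
      by (simp add: d P.scale diff_divide_distrib flip: F.scale_minus_left)
    finally show ?thesis by (simp only: coeff)
  qed
  have skew: "br (d m) (d n) = - br (d n) (d m)" for n m
    by (rule H.br_skew[OF dW dW])
  have jac: "br (fscale (p powi n + q powi n) (d n)) (br (d m) (d k)) +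
      br (fscale (p powi m + q powi m) (d m)) (br (d k) (d n)) +
      br (fscale (p powi k + q powi k) (d k)) (br (d n) (d m)) = 0" for n m k
    using H.hom_jacobi[OF dW[of n] dW[of m] dW[of k]] by (simp only: ov_d)
  have ov_act: "overline D (\<sigma> + \<tau>) (act a D) = act ((\<sigma> + \<tau>) a) D" for a
    using ov[of a] by (simp only: \<Phi>_def)
  show ?thesis
    by (intro conjI exI[of _ br] allI der inj_d indep ov_act ov_d hl br_d skew jac)
      (simp only: coeff)
qed

end
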